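(* Let $\Sigma$ and $\overline{\Sigma}$ be disjoint nonempty finite sets and let $\kappa : \Sigma \to \overline{\Sigma}$ be a bijection. Then $$\log_2 |\Sigma| \le h(D(\kappa)) \le \log_2(2|\Sigma| - 1).$$
   Context: Let $\Delta := \Sigma\cup\overline{\Sigma}$, let $\Delta^{*}$ be the free monoid of words over $\Delta$, and let $\Delta^{(n)}$ be the set of words over $\Delta$ of length at most $n$. For a word $u$ and a letter $c$, $|u|_c$ is the number of occurrences of $c$ in $u$. Let $F(\Sigma)$ be the free group on $\Sigma$ with neutral element $e$, and let $\phi : \Delta^{*}\to F(\Sigma)$ be the unique monoid homomorphism with $\phi(a)=a$ and $\phi(\kappa(a))=a^{-1}$ for all $a\in\Sigma$. Define $$D(\kappa) := \{ w\in\Delta^{*} \mid \phi(w)=e \text{ and for every prefix } u \text{ of } w \text{ and every } a\in\Sigma:\ |u|_a \ge |u|_{\kappa(a)} \}.$$ For a language $L\subseteq\Delta^{*}$ and finite $E\subseteq\Delta^{*}$ let $\Theta(E,L)$ be the equivalence relation on $\Delta^{*}$ with $(u,v)\in\Theta(E,L)$ iff for all $w\in E$: $uw\in L\Leftrightarrow vw\in L$. Let $\gamma_L(E)$ be the (finite) number of its equivalence classes. The Myhill-Nerode entropy of $L$ is $h(L) := \limsup_{n\to\infty}\frac{1}{n}\log_2\gamma_L(\Delta^{(n)})$. *)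

theory Defs
  imports "HOL-Algebra.Group" "HOL-Library.Sublist" "HOL-Library.Extended_Real"
    "HOL-Library.Liminf_Limsup" Complex_Main
begin

text \<open>
  The free group on \<open>S\<close>, realised by reduced words. The pair \<open>(a, True)\<close> stands for the
  generator \<open>a\<close> and \<open>(a, False)\<close> for its formal inverse; the product is concatenation
  followed by free reduction. The lemmas \<open>free_group_is_group\<close> and
  \<open>free_group_universal\<close> confirm that this is a group with the universal property.
\<close>

definition inv_letter :: "'a \<times> bool \<Rightarrow> 'a \<times> bool" where
  "inv_letter x = (fst x, \<not> snd x)"

fun reduced :: "('a \<times> bool) list \<Rightarrow> bool" where
  "reduced [] = True"
| "reduced [x] = True"
| "reduced (x # y # w) = (y \<noteq> inv_letter x \<and> reduced (y # w))"

fun push_letter :: "'a \<times> bool \<Rightarrow> ('a \<times> bool) list \<Rightarrow> ('a \<times> bool) list" where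
  "push_letter x [] = [x]"
| "push_letter x (y # w) = (if y = inv_letter x then w else x # y # w)"

definition free_group :: "'a set \<Rightarrow> ('a \<times> bool) list monoid" where
  "free_group S = \<lparr>carrier = {w \<in> lists (S \<times> UNIV). reduced w},
                   monoid.mult = (\<lambda>u v. foldr push_letter u v),
                   one = []\<rparr>"

text \<open>
  The homomorphism \<open>\<phi>\<close> from words over \<open>\<Sigma> \<union> \<kappa> ` \<Sigma>\<close> to the free group on \<open>\<Sigma>\<close>;
  see \<open>phi_hom\<close> and \<open>phi_unique\<close>.
\<close>

definition phi_letter :: "'a set \<Rightarrow> ('a \<Rightarrow> 'a) \<Rightarrow> 'a \<Rightarrow> ('a \<times> bool) list" where
  "phi_letter \<Sigma> \<kappa> c =
     (if c \<in> \<Sigma> then [(c, True)] else inv\<^bsub>free_group \<Sigma>\<^esub> [(the_inv_into \<Sigma> \<kappa> c, True)])"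

fun phi :: "'a set \<Rightarrow> ('a \<Rightarrow> 'a) \<Rightarrow> 'a list \<Rightarrow> ('a \<times> bool) list" where
  "phi \<Sigma> \<kappa> [] = \<one>\<^bsub>free_group \<Sigma>\<^esub>"
| "phi \<Sigma> \<kappa> (c # w) = phi_letter \<Sigma> \<kappa> c \<otimes>\<^bsub>free_group \<Sigma>\<^esub> phi \<Sigma> \<kappa> w"

definition free_monoid :: "'a set \<Rightarrow> 'a list monoid" where
  "free_monoid A = \<lparr>carrier = lists A, monoid.mult = (@), one = []\<rparr>"

definition dyck :: "'a set \<Rightarrow> 'a set \<Rightarrow> ('a \<Rightarrow> 'a) \<Rightarrow> 'a list set" where
  "dyck \<Sigma> \<Sigma>' \<kappa> = {w \<in> lists (\<Sigma> \<union> \<Sigma>').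
      phi \<Sigma> \<kappa> w = \<one>\<^bsub>free_group \<Sigma>\<^esub> \<and>
      (\<forall>u. prefix u w \<longrightarrow> (\<forall>a\<in>\<Sigma>. count_list u a \<ge> count_list u (\<kappa> a)))}"

definition words_upto :: "'a set \<Rightarrow> nat \<Rightarrow> 'a list set" where
  "words_upto \<Delta> n = {w \<in> lists \<Delta>. length w \<le> n}"

definition Theta :: "'a set \<Rightarrow> 'a list set \<Rightarrow> 'a list set \<Rightarrow> ('a list \<times> 'a list) set" where
  "Theta \<Delta> E L = {(u, v). u \<in> lists \<Delta> \<and> v \<in> lists \<Delta> \<and> (\<forall>w\<in>E. u @ w \<in> L \<longleftrightarrow> v @ w \<in> L)}"

definition gamma :: "'a set \<Rightarrow> 'a list set \<Rightarrow> 'a list set \<Rightarrow> nat" where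
  "gamma \<Delta> L E = card (lists \<Delta> // Theta \<Delta> E L)"

text \<open>
  The entropy is extended-real-valued because an upper limit of reals need not be finite.
  The term for \<open>n = 0\<close> is \<open>0\<close> by division by zero and does not affect the limit.
\<close>

definition MN_entropy :: "'a set \<Rightarrow> 'a list set \<Rightarrow> ereal" where
  "MN_entropy \<Delta> L =
     limsup (\<lambda>n. ereal (1 / real n * log 2 (real (gamma \<Delta> L (words_upto \<Delta> n)))))"

lemma equiv_Theta: "equiv (lists \<Delta>) (Theta \<Delta> E L)"
  by (auto simp: equiv_def refl_on_def sym_def trans_def Theta_def)

text \<open>Hence \<open>card\<close> in \<open>gamma\<close> never sees an infinite set when \<open>E\<close> is finite.\<close>

lemma finite_classes:
  assumes "finite E"
  shows "finite (lists \<Delta> // Theta \<Delta> E L)"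
proof -
  define f where "f u = {w \<in> E. u @ w \<in> L}" for u
  have "lists \<Delta> // Theta \<Delta> E L \<subseteq> (\<lambda>S. {v \<in> lists \<Delta>. f v = S}) ` Pow E"
  proof
    fix X assume "X \<in> lists \<Delta> // Theta \<Delta> E L"
    then obtain u where u: "u \<in> lists \<Delta>" "X = Theta \<Delta> E L `` {u}"
      by (rule quotientE) blast
    then have "X = {v \<in> lists \<Delta>. f v = f u}"
      by (auto simp: Theta_def f_def)
    moreover have "f u \<in> Pow E" by (auto simp: f_def)
    ultimately show "X \<in> (\<lambda>S. {v \<in> lists \<Delta>. f v = S}) ` Pow E" by blast
  qed
  then show ?thesis using assms by (meson finite_Pow_iff finite_imageI finite_subset)
qed

lemma finite_words_upto: "finite \<Delta> \<Longrightarrow> finite (words_upto \<Delta> n)"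
  using finite_lists_length_le[of \<Delta> n] by (simp add: words_upto_def lists_eq_set Collect_conj_eq
      Int_commute conj_commute)

lemma inv_letter_inv_letter [simp]: "inv_letter (inv_letter x) = x"
  by (simp add: inv_letter_def)

lemma reduced_Cons: "reduced (x # w) \<longleftrightarrow> reduced w \<and> (w = [] \<or> hd w \<noteq> inv_letter x)"
  by (cases w) auto

lemma reduced_push: "reduced w \<Longrightarrow> reduced (push_letter x w)"
  by (cases w) (auto simp: reduced_Cons)

lemma push_inv: "reduced w \<Longrightarrow> push_letter x (push_letter (inv_letter x) w) = w"
proof (cases w)
  case (Cons y v)
  assume "reduced w"
  then show ?thesis using Cons by (cases v) auto
qed simp

lemma push_inv': "reduced w \<Longrightarrow> push_letter (inv_letter x) (push_letter x w) = w"
  using push_inv[of w "inv_letter x"] by simp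

lemma reduced_foldr_push: "reduced w \<Longrightarrow> reduced (foldr push_letter u w)"
  by (induction u) (auto simp: reduced_push)

lemma foldr_push_push:
  "reduced w \<Longrightarrow> foldr push_letter (push_letter x v) w = push_letter x (foldr push_letter v w)"
  by (cases v) (auto simp: push_inv reduced_foldr_push)

lemma foldr_push_assoc:
  "reduced w \<Longrightarrow>
    foldr push_letter (foldr push_letter u v) w = foldr push_letter u (foldr push_letter v w)"
  by (induction u) (auto simp: foldr_push_push)

lemma foldr_push_Nil: "reduced u \<Longrightarrow> foldr push_letter u [] = u"
proof (induction u)
  case (Cons x u)
  then show ?case by (cases u) auto
qed simp

lemma foldr_push_inverse:
  "reduced v \<Longrightarrow> foldr push_letter (rev (map inv_letter w)) (foldr push_letter w v) = v"
  by (induction w arbitrary: v) (auto simp: push_inv' reduced_foldr_push)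

lemma push_in_lists:
  "x \<in> S \<times> UNIV \<Longrightarrow> w \<in> lists (S \<times> UNIV) \<Longrightarrow> push_letter x w \<in> lists (S \<times> UNIV)"
  by (cases w) auto

lemma foldr_push_in_lists:
  "u \<in> lists (S \<times> UNIV) \<Longrightarrow> w \<in> lists (S \<times> UNIV) \<Longrightarrow> foldr push_letter u w \<in> lists (S \<times> UNIV)"
proof (induction u)
  case (Cons x u)
  then have "x \<in> S \<times> UNIV" "foldr push_letter u w \<in> lists (S \<times> UNIV)" by auto
  then show ?case using push_in_lists by fastforce
qed simp

lemma free_group_is_group: "group (free_group S)"
proof (rule groupI)
  fix w assume w: "w \<in> carrier (free_group S)"
  let ?v = "rev (map inv_letter w)"
  let ?u = "foldr push_letter ?v []"
  have l: "w \<in> lists (S \<times> UNIV)" and r: "reduced w" using w by (auto simp: free_group_def)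
  have "?v \<in> lists (S \<times> UNIV)" using l by (fastforce simp: inv_letter_def)
  then have "?u \<in> lists (S \<times> UNIV)" using foldr_push_in_lists by blast
  moreover have "reduced ?u" by (rule reduced_foldr_push) simp
  moreover have "foldr push_letter ?u w = []"
  proof -
    have "foldr push_letter ?u w = foldr push_letter ?v w"
      using foldr_push_assoc[OF r, of ?v "[]"] by simp
    also have "\<dots> = foldr push_letter ?v (foldr push_letter w [])"
      using r by (simp only: foldr_push_Nil)
    also have "\<dots> = []" by (rule foldr_push_inverse) simp
    finally show ?thesis .
  qed
  ultimately show "\<exists>y\<in>carrier (free_group S). y \<otimes>\<^bsub>free_group S\<^esub> w = \<one>\<^bsub>free_group S\<^esub>"
    by (intro bexI[of _ ?u]) (simp_all add: free_group_def)
qed (simp_all add: free_group_def foldr_push_assoc reduced_foldr_push foldr_push_in_lists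
      del: in_lists_conv_set)

text \<open>Every map \<open>f\<close> from \<open>S\<close> to a group extends uniquely to a homomorphism.\<close>

lemma free_group_universal:
  assumes G: "group G" and f: "f \<in> S \<rightarrow> carrier G"
  shows "\<exists>h \<in> hom (free_group S) G. (\<forall>a\<in>S. h [(a, True)] = f a) \<and>
           (\<forall>h' \<in> hom (free_group S) G. (\<forall>a\<in>S. h' [(a, True)] = f a) \<longrightarrow>
              (\<forall>w \<in> carrier (free_group S). h' w = h w))"
proof -
  interpret G: group G by fact
  interpret F: group "free_group S" by (rule free_group_is_group)
  define g where "g x = (if snd x then f (fst x) else inv\<^bsub>G\<^esub> f (fst x))" for x
  define h where "h w = foldr (\<lambda>x y. g x \<otimes>\<^bsub>G\<^esub> y) w \<one>\<^bsub>G\<^esub>" for w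
  have gc: "g x \<in> carrier G" if "x \<in> S \<times> UNIV" for x
    using that f by (auto simp: g_def)
  have ginv: "g x \<otimes>\<^bsub>G\<^esub> g (inv_letter x) = \<one>\<^bsub>G\<^esub>" if "x \<in> S \<times> UNIV" for x
    using that f by (auto simp: g_def inv_letter_def Pi_iff)
  have hc: "h w \<in> carrier G" if "w \<in> lists (S \<times> UNIV)" for w
    using that by (induction w rule: lists.induct) (auto simp: h_def gc)
  have hpush: "h (push_letter x w) = g x \<otimes>\<^bsub>G\<^esub> h w"
    if "x \<in> S \<times> UNIV" "w \<in> lists (S \<times> UNIV)" for x w
  proof (cases "\<exists>v. w = inv_letter x # v")
    case True
    then obtain v where v: "w = inv_letter x # v" by blast
    have ix: "inv_letter x \<in> S \<times> UNIV" using that by (auto simp: inv_letter_def)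
    have vl: "v \<in> lists (S \<times> UNIV)" using that v by simp
    have "g x \<otimes>\<^bsub>G\<^esub> h w = (g x \<otimes>\<^bsub>G\<^esub> g (inv_letter x)) \<otimes>\<^bsub>G\<^esub> h v"
      using G.m_assoc[OF gc[OF that(1)] gc[OF ix] hc[OF vl]] by (simp add: v h_def)
    then show ?thesis using ginv[OF that(1)] hc[OF vl] v by simp
  next
    case False
    then have "push_letter x w = x # w" by (cases w) auto
    then show ?thesis by (simp add: h_def)
  qed
  have hmult: "h (foldr push_letter u v) = h u \<otimes>\<^bsub>G\<^esub> h v"
    if "u \<in> lists (S \<times> UNIV)" "v \<in> lists (S \<times> UNIV)" for u v
    using that(1)
  proof (induction u rule: lists.induct)
    case Nil
    then show ?case using hc[OF that(2)] by (simp add: h_def)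
  next
    case (Cons x u)
    have "h (foldr push_letter (x # u) v) = g x \<otimes>\<^bsub>G\<^esub> h (foldr push_letter u v)"
      using hpush[OF Cons.hyps(1) foldr_push_in_lists[OF Cons.hyps(2) that(2)]] by simp
    also have "\<dots> = (g x \<otimes>\<^bsub>G\<^esub> h u) \<otimes>\<^bsub>G\<^esub> h v"
      using Cons.IH G.m_assoc[OF gc[OF Cons.hyps(1)] hc[OF Cons.hyps(2)] hc[OF that(2)]] by simp
    finally show ?case by (simp add: h_def)
  qed
  have hhom: "h \<in> hom (free_group S) G"
    by (rule homI) (simp_all add: free_group_def hc hmult del: in_lists_conv_set)
  have hgen: "\<forall>a\<in>S. h [(a, True)] = f a" using f by (auto simp: h_def g_def Pi_iff)
  have uniq: "h' w = h w" if h': "h' \<in> hom (free_group S) G"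
    and gen: "\<forall>a\<in>S. h' [(a, True)] = f a" and w: "w \<in> carrier (free_group S)" for h' w
  proof -
    interpret H: group_hom "free_group S" G h'
      by (simp add: group_hom_def group_hom_axioms_def h' G.is_group F.is_group)
    have let1: "h' [x] = g x" if x: "x \<in> S \<times> UNIV" for x
    proof (cases x)
      case (Pair a b)
      then have a: "a \<in> S" using x by simp
      then have c: "[(a, True)] \<in> carrier (free_group S)" "[(a, False)] \<in> carrier (free_group S)"
        by (auto simp: free_group_def)
      have "[(a, False)] \<otimes>\<^bsub>free_group S\<^esub> [(a, True)] = \<one>\<^bsub>free_group S\<^esub>"
        by (simp add: free_group_def inv_letter_def)
      then have "inv\<^bsub>free_group S\<^esub> [(a, True)] = [(a, False)]"
        using c by (simp add: F.inv_equality)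
      then have "h' [(a, False)] = inv\<^bsub>G\<^esub> (h' [(a, True)])" using H.hom_inv[OF c(1)] by simp
      then show ?thesis using gen a Pair by (cases b) (auto simp: g_def)
    qed
    from w have "w \<in> lists (S \<times> UNIV)" "reduced w" by (auto simp: free_group_def)
    then show ?thesis
    proof (induction w rule: lists.induct)
      case Nil
      then show ?case using H.hom_one by (simp add: free_group_def h_def)
    next
      case (Cons x w)
      then have rw: "reduced w" by (simp add: reduced_Cons)
      have c: "[x] \<in> carrier (free_group S)" "w \<in> carrier (free_group S)"
        using Cons rw by (auto simp: free_group_def)
      have "[x] \<otimes>\<^bsub>free_group S\<^esub> w = x # w"
        using Cons.prems by (cases w) (auto simp: free_group_def)
      then have "h' (x # w) = h' [x] \<otimes>\<^bsub>G\<^esub> h' w" using H.hom_mult[OF c] by simp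
      also have "\<dots> = g x \<otimes>\<^bsub>G\<^esub> h w" using let1[OF Cons.hyps(1)] Cons.IH[OF rw] by simp
      finally show ?case by (simp add: h_def)
    qed
  qed
  show ?thesis using hhom hgen uniq by blast
qed

context
  fixes \<Sigma> \<Sigma>' :: "'a set" and \<kappa> :: "'a \<Rightarrow> 'a"
  assumes disj: "\<Sigma> \<inter> \<Sigma>' = {}" and bij: "bij_betw \<kappa> \<Sigma> \<Sigma>'"
begin

lemma gen_in_free_group: "a \<in> \<Sigma> \<Longrightarrow> [(a, True)] \<in> carrier (free_group \<Sigma>)"
  by (simp add: free_group_def)

lemma phi_letter_closed: "c \<in> \<Sigma> \<union> \<Sigma>' \<Longrightarrow> phi_letter \<Sigma> \<kappa> c \<in> carrier (free_group \<Sigma>)"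
  using bij the_inv_into_into[of \<kappa> \<Sigma> c \<Sigma>] gen_in_free_group
    group.inv_closed[OF free_group_is_group[of \<Sigma>]]
  by (auto simp: phi_letter_def bij_betw_def)

lemma phi_closed: "w \<in> lists (\<Sigma> \<union> \<Sigma>') \<Longrightarrow> phi \<Sigma> \<kappa> w \<in> carrier (free_group \<Sigma>)"
proof (induction w rule: lists.induct)
  case Nil
  show ?case using group.is_monoid[OF free_group_is_group] monoid.one_closed by fastforce
next
  case (Cons c w)
  then show ?case
    using monoid.m_closed[OF group.is_monoid[OF free_group_is_group] phi_letter_closed] by simp
qed

lemma phi_hom: "phi \<Sigma> \<kappa> \<in> hom (free_monoid (\<Sigma> \<union> \<Sigma>')) (free_group \<Sigma>)"
proof (rule homI)
  interpret F: group "free_group \<Sigma>" by (rule free_group_is_group)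
  fix u v assume uv: "u \<in> carrier (free_monoid (\<Sigma> \<union> \<Sigma>'))" "v \<in> carrier (free_monoid (\<Sigma> \<union> \<Sigma>'))"
  then have u: "u \<in> lists (\<Sigma> \<union> \<Sigma>')" and v: "v \<in> lists (\<Sigma> \<union> \<Sigma>')"
    by (simp_all add: free_monoid_def del: in_lists_conv_set)
  from u have "phi \<Sigma> \<kappa> (u @ v) = phi \<Sigma> \<kappa> u \<otimes>\<^bsub>free_group \<Sigma>\<^esub> phi \<Sigma> \<kappa> v"
  proof (induction u rule: lists.induct)
    case Nil
    then show ?case using phi_closed[OF v] by simp
  next
    case (Cons c u)
    then show ?case
      using F.m_assoc[OF phi_letter_closed[OF Cons.hyps(1)] phi_closed[OF Cons.hyps(2)] phi_closed[OF v]]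
      by simp
  qed
  then show "phi \<Sigma> \<kappa> (u \<otimes>\<^bsub>free_monoid (\<Sigma> \<union> \<Sigma>')\<^esub> v) =
      phi \<Sigma> \<kappa> u \<otimes>\<^bsub>free_group \<Sigma>\<^esub> phi \<Sigma> \<kappa> v" by (simp add: free_monoid_def)
qed (simp add: free_monoid_def phi_closed del: in_lists_conv_set)

lemma phi_gen:
  assumes "a \<in> \<Sigma>"
  shows "phi \<Sigma> \<kappa> [a] = [(a, True)]"
    and "phi \<Sigma> \<kappa> [\<kappa> a] = inv\<^bsub>free_group \<Sigma>\<^esub> [(a, True)]"
proof -
  interpret F: group "free_group \<Sigma>" by (rule free_group_is_group)
  have k: "\<kappa> a \<in> \<Sigma>'" "inj_on \<kappa> \<Sigma>" using bij assms by (auto simp: bij_betw_def)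
  then have "\<kappa> a \<notin> \<Sigma>" using disj by blast
  then have "phi_letter \<Sigma> \<kappa> (\<kappa> a) = inv\<^bsub>free_group \<Sigma>\<^esub> [(a, True)]"
    using assms k by (simp add: phi_letter_def the_inv_into_f_f)
  then show "phi \<Sigma> \<kappa> [\<kappa> a] = inv\<^bsub>free_group \<Sigma>\<^esub> [(a, True)]"
    using gen_in_free_group[OF assms] by simp
  show "phi \<Sigma> \<kappa> [a] = [(a, True)]"
    using gen_in_free_group[OF assms] assms by (simp add: phi_letter_def)
qed

lemma phi_unique:
  assumes h: "h \<in> hom (free_monoid (\<Sigma> \<union> \<Sigma>')) (free_group \<Sigma>)"
    and one: "h [] = \<one>\<^bsub>free_group \<Sigma>\<^esub>"
    and gen: "\<And>a. a \<in> \<Sigma> \<Longrightarrow> h [a] = [(a, True)]"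
      "\<And>a. a \<in> \<Sigma> \<Longrightarrow> h [\<kappa> a] = inv\<^bsub>free_group \<Sigma>\<^esub> [(a, True)]"
    and w: "w \<in> lists (\<Sigma> \<union> \<Sigma>')"
  shows "h w = phi \<Sigma> \<kappa> w"
  using w
proof (induction w rule: lists.induct)
  case Nil
  then show ?case using one by simp
next
  case (Cons c w)
  interpret F: group "free_group \<Sigma>" by (rule free_group_is_group)
  have "h [c] = phi \<Sigma> \<kappa> [c]"
  proof (cases "c \<in> \<Sigma>")
    case True
    then show ?thesis using gen(1) phi_gen(1) by metis
  next
    case False
    then obtain a where "a \<in> \<Sigma>" "c = \<kappa> a" using Cons.hyps(1) bij by (auto simp: bij_betw_def)
    then show ?thesis using gen(2) phi_gen(2) by metis
  qed
  moreover have "phi \<Sigma> \<kappa> [c] = phi_letter \<Sigma> \<kappa> c"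
    using phi_letter_closed[OF Cons.hyps(1)] by simp
  moreover have "h ([c] @ w) = h [c] \<otimes>\<^bsub>free_group \<Sigma>\<^esub> h w"
    using hom_mult[OF h, of "[c]" w] Cons.hyps by (simp add: free_monoid_def)
  ultimately show ?case using Cons.IH by simp
qed

end

end

(* Whether u @ w lies in the Dyck language depends, for a fixed w, only on phi(u) and on
   whether some prefix of u already violates the counting condition, because |u|_a - |u|_kappa(a)
   is the exponent sum of a in phi(u).  If u @ w lies in the language and |w| <= n, then
   phi(u) = phi(w)^-1 has reduced length at most n.  Hence the words of length at most n
   distinguish at most 1 + |B_n| classes, where B_n is the ball of radius n in the free group,
   whose exponential growth rate is 2|Sigma| - 1.  Conversely the |Sigma|^n positive words u of
   length n are pairwise distinguished, u being the only one completed by the formal inverse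
   of u. *)

theory Submission
  imports Defs "HOL-Real_Asymp.Real_Asymp"
begin

section \<open>Counting Myhill-Nerode classes\<close>

text \<open>A class is determined by the completions in \<open>E\<close> that its members admit, so
  counting classes amounts to counting residuals restricted to \<open>E\<close>.\<close>

lemma gamma_eq_card_residuals:
  "gamma \<Delta> L E = card ((\<lambda>u. {w \<in> E. u @ w \<in> L}) ` lists \<Delta>)"
proof -
  let ?f = "\<lambda>u. {w \<in> E. u @ w \<in> L}"
  have cls: "Theta \<Delta> E L `` {u} = {v \<in> lists \<Delta>. ?f v = ?f u}" if "u \<in> lists \<Delta>" for u
    using that by (auto simp: Theta_def)
  have "lists \<Delta> // Theta \<Delta> E L = (\<lambda>S. {v \<in> lists \<Delta>. ?f v = S}) ` ?f ` lists \<Delta>"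
    unfolding quotient_def image_image using cls by blast
  moreover have "inj_on (\<lambda>S. {v \<in> lists \<Delta>. ?f v = S}) (?f ` lists \<Delta>)"
    by (rule inj_onI) blast
  ultimately show ?thesis
    unfolding gamma_def by (simp add: card_image)
qed

text \<open>Separation makes the residuals of words in \<open>U\<close> pairwise different.
  Finiteness of \<open>E\<close> makes the set of all residuals finite, so that \<open>card\<close>
  is monotone.\<close>

lemma card_le_gamma:
  assumes E: "finite E" and U: "U \<subseteq> lists \<Delta>"
    and sep: "\<And>u v. u \<in> U \<Longrightarrow> v \<in> U \<Longrightarrow> u \<noteq> v \<Longrightarrow> \<exists>w\<in>E. u @ w \<in> L \<and> v @ w \<notin> L"
  shows "card U \<le> gamma \<Delta> L E"
proof -
  let ?f = "\<lambda>u. {w \<in> E. u @ w \<in> L}"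
  have "inj_on ?f U"
    by (rule inj_onI) (use sep in blast)
  moreover have "finite (?f ` lists \<Delta>)"
    by (rule finite_subset[of _ "Pow E"]) (use E in auto)
  ultimately show ?thesis
    unfolding gamma_eq_card_residuals by (metis (no_types, lifting) U card_image card_mono image_mono)
qed

text \<open>Keeps the argument of the logarithm positive, as its monotonicity requires: the empty
  word always has a class.\<close>

lemma gamma_pos:
  assumes "finite \<Delta>"
  shows "0 < gamma \<Delta> L (words_upto \<Delta> n)"
  using finite_classes[OF finite_words_upto[OF assms, of n], of \<Delta> L]
  by (auto simp: gamma_def card_gt_0_iff quotient_is_empty)

section \<open>Length and growth in the free group\<close>

lemma inv_letter_in_iff [simp]: "inv_letter x \<in> S \<times> UNIV \<longleftrightarrow> x \<in> S \<times> UNIV"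
  by (cases x) (simp add: inv_letter_def)

lemma inv_free_group_gen:
  assumes "a \<in> S"
  shows "inv\<^bsub>free_group S\<^esub> [(a, True)] = [(a, False)]"
proof -
  interpret F: group "free_group S" by (rule free_group_is_group)
  show ?thesis
    by (rule F.inv_equality) (use assms in \<open>simp_all add: free_group_def inv_letter_def\<close>)
qed

lemma length_foldr_push_le: "length (foldr push_letter u v) \<le> length u + length v"
proof (induction u)
  case (Cons x u)
  then show ?case by (cases "foldr push_letter u v") auto
qed simp

text \<open>Pushing a letter cancels at most one letter. When the product is trivial, this bounds
  the length of an element by that of its inverse.\<close>

lemma length_foldr_push_ge: "length v \<le> length u + length (foldr push_letter u v)"
proof (induction u)
  case (Cons x u)
  then show ?case by (cases "foldr push_letter u v") auto
qed simp

text \<open>The sphere of radius \<open>n\<close> about the identity in the word metric of the free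
  group.\<close>

definition reduced_words :: "'a set \<Rightarrow> nat \<Rightarrow> ('a \<times> bool) list set" where
  "reduced_words S n = {w \<in> lists (S \<times> UNIV). reduced w \<and> length w = n}"

lemma finite_reduced_words: "finite S \<Longrightarrow> finite (reduced_words S n)"
  by (rule finite_subset[OF _ finite_lists_length_eq[of "S \<times> (UNIV :: bool set)" n]])
    (auto simp: reduced_words_def)

text \<open>A letter prepended to a nonempty reduced word can only cancel against its head, so
  exactly one letter is forbidden. Lengths start at two because the empty word has no head to
  avoid.\<close>

lemma reduced_words_Suc_Suc:
  "reduced_words S (Suc (Suc n)) =
    (\<lambda>(w, x). x # w) ` (SIGMA w : reduced_words S (Suc n). S \<times> UNIV - {inv_letter (hd w)})"
proof (intro equalityI subsetI)
  fix v assume v: "v \<in> reduced_words S (Suc (Suc n))"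
  then obtain x y w where "v = x # y # w"
    by (auto simp: reduced_words_def length_Suc_conv)
  with v show "v \<in> (\<lambda>(w, x). x # w) `
      (SIGMA w : reduced_words S (Suc n). S \<times> UNIV - {inv_letter (hd w)})"
    by (intro image_eqI[of _ _ "(y # w, x)"]) (auto simp: reduced_words_def)
next
  fix v assume "v \<in> (\<lambda>(w, x). x # w) `
      (SIGMA w : reduced_words S (Suc n). S \<times> UNIV - {inv_letter (hd w)})"
  then show "v \<in> reduced_words S (Suc (Suc n))"
    by (auto simp: reduced_words_def reduced_Cons)
qed

lemma card_reduced_words_Suc:
  assumes "finite S"
  shows "card (reduced_words S (Suc n)) = 2 * card S * (2 * card S - 1) ^ n"
proof (induction n)
  case 0
  have "reduced_words S (Suc 0) = (\<lambda>x. [x]) ` (S \<times> UNIV)"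
    by (auto simp: reduced_words_def length_Suc_conv)
  then show ?case
    by (simp add: card_image inj_on_def card_cartesian_product card_UNIV_bool mult.commute)
next
  case (Suc n)
  let ?R = "reduced_words S (Suc n)"
  have "card (S \<times> (UNIV :: bool set) - {inv_letter (hd w)}) = 2 * card S - 1" if "w \<in> ?R" for w
  proof -
    \<comment> \<open>The forbidden letter belongs to the alphabet, so removing it costs exactly one
      choice.\<close>
    have "inv_letter (hd w) \<in> S \<times> UNIV"
      unfolding inv_letter_in_iff using that by (cases w) (auto simp: reduced_words_def)
    then show ?thesis
      by (simp add: card_cartesian_product card_UNIV_bool mult.commute)
  qed
  then have "card (SIGMA w : ?R. S \<times> (UNIV :: bool set) - {inv_letter (hd w)}) =
      card ?R * (2 * card S - 1)"
    using assms by (simp add: finite_reduced_words)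
  moreover have "inj_on (\<lambda>(w, x). x # w) X" for X :: "(('a \<times> bool) list \<times> 'a \<times> bool) set"
    by (auto simp: inj_on_def)
  ultimately show ?case
    using Suc by (simp add: reduced_words_Suc_Suc card_image)
qed

text \<open>Each sphere of positive radius is estimated with the exponent \<open>n\<close>. This
  loses only a factor linear in \<open>n\<close>, invisible to the entropy, and covers base 1, where
  the geometric sum formula would divide by zero.\<close>

lemma card_ball_le:
  assumes "finite S" "S \<noteq> {}"
  shows "card (\<Union>m\<le>n. reduced_words S m) \<le> 1 + 2 * card S * n * (2 * card S - 1) ^ n"
proof -
  have ge1: "2 * card S - 1 \<ge> 1"
    using card_gt_0_iff[of S] assms by linarith
  have "card (\<Union>m\<le>n. reduced_words S m) \<le> (\<Sum>m\<le>n. card (reduced_words S m))"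
    by (rule card_UN_le) simp
  also have "\<dots> = card (reduced_words S 0) + (\<Sum>m<n. card (reduced_words S (Suc m)))"
    by (rule sum.atMost_shift)
  also have "reduced_words S 0 = {[]}"
    by (auto simp: reduced_words_def)
  also have "(\<Sum>m<n. card (reduced_words S (Suc m))) \<le>
      (\<Sum>m<n. 2 * card S * (2 * card S - 1) ^ n)"
    unfolding card_reduced_words_Suc[OF assms(1)]
    by (intro sum_mono mult_left_mono power_increasing) (use ge1 in auto)
  finally show ?thesis
    by (simp add: mult_ac)
qed

text \<open>The \<open>a\<close>-coordinate of the image in the abelianised free group.\<close>

definition exponent_sum :: "'a \<Rightarrow> ('a \<times> bool) list \<Rightarrow> int" where
  "exponent_sum a w = int (count_list w (a, True)) - int (count_list w (a, False))"

text \<open>The contributions of a cancelling pair add up to 0, so free reduction preserves the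
  sum.\<close>

lemma exponent_sum_push: "exponent_sum a (push_letter x w) = exponent_sum a (x # w)"
  by (cases w; cases x) (auto simp: exponent_sum_def inv_letter_def)

section \<open>The Dyck language\<close>

definition prefix_dominant :: "'a set \<Rightarrow> ('a \<Rightarrow> 'a) \<Rightarrow> 'a list \<Rightarrow> bool" where
  "prefix_dominant \<Sigma> \<kappa> u \<longleftrightarrow>
     (\<forall>p. prefix p u \<longrightarrow> (\<forall>a\<in>\<Sigma>. count_list p (\<kappa> a) \<le> count_list p a))"

lemma reduced_positive: "reduced (map (\<lambda>a. (a, True)) u)"
  by (induction u rule: induct_list012) (auto simp: inv_letter_def)

context
  fixes \<Sigma> \<Sigma>' :: "'a set" and \<kappa> :: "'a \<Rightarrow> 'a"
  assumes disj: "\<Sigma> \<inter> \<Sigma>' = {}" and bij: "bij_betw \<kappa> \<Sigma> \<Sigma>'"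
begin

section \<open>Recursion, length and exponent sums for the homomorphism \<open>phi\<close>\<close>

lemma phi_simps [simp]:
  assumes "a \<in> \<Sigma>"
  shows "phi \<Sigma> \<kappa> (a # w) = push_letter (a, True) (phi \<Sigma> \<kappa> w)"
    and "phi \<Sigma> \<kappa> (\<kappa> a # w) = push_letter (a, False) (phi \<Sigma> \<kappa> w)"
proof -
  have "phi_letter \<Sigma> \<kappa> a = [(a, True)]"
    using assms by (simp add: phi_letter_def)
  moreover have "phi_letter \<Sigma> \<kappa> (\<kappa> a) = [(a, False)]"
    using assms disj bij
    by (auto simp: phi_letter_def bij_betw_def the_inv_into_f_f inv_free_group_gen)
  ultimately show "phi \<Sigma> \<kappa> (a # w) = push_letter (a, True) (phi \<Sigma> \<kappa> w)"
    "phi \<Sigma> \<kappa> (\<kappa> a # w) = push_letter (a, False) (phi \<Sigma> \<kappa> w)"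
    by (simp_all add: free_group_def)
qed

declare phi.simps(2) [simp del]

text \<open>Every letter of \<Sigma>' has the form \<open>\<kappa> a\<close>, since \<kappa> is
  onto; the cases then match the equations for \<open>phi\<close>.\<close>

lemma word_induct [consumes 1, case_names Nil Pos Neg]:
  assumes "w \<in> lists (\<Sigma> \<union> \<Sigma>')"
    and "P []"
    and "\<And>a w. a \<in> \<Sigma> \<Longrightarrow> w \<in> lists (\<Sigma> \<union> \<Sigma>') \<Longrightarrow> P w \<Longrightarrow> P (a # w)"
    and "\<And>a w. a \<in> \<Sigma> \<Longrightarrow> w \<in> lists (\<Sigma> \<union> \<Sigma>') \<Longrightarrow> P w \<Longrightarrow> P (\<kappa> a # w)"
  shows "P w"
  using assms(1)
proof (induction w rule: lists.induct)
  case (Cons c w)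
  then show ?case using assms(3,4) bij by (auto simp: bij_betw_def simp del: in_lists_conv_set)
qed (rule assms(2))

lemma phi_append:
  assumes "u \<in> lists (\<Sigma> \<union> \<Sigma>')" "v \<in> lists (\<Sigma> \<union> \<Sigma>')"
  shows "phi \<Sigma> \<kappa> (u @ v) = phi \<Sigma> \<kappa> u \<otimes>\<^bsub>free_group \<Sigma>\<^esub> phi \<Sigma> \<kappa> v"
  using hom_mult[OF phi_hom[OF disj bij], of u v] assms
  by (simp add: free_monoid_def del: in_lists_conv_set)

lemma length_phi_le: "w \<in> lists (\<Sigma> \<union> \<Sigma>') \<Longrightarrow> length (phi \<Sigma> \<kappa> w) \<le> length w"
proof (induction w rule: word_induct)
  case Nil
  then show ?case by (simp add: free_group_def)
next
  case (Pos a w)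
  then show ?case using length_foldr_push_le[of "[(a, True)]" "phi \<Sigma> \<kappa> w"] by simp
next
  case (Neg a w)
  then show ?case using length_foldr_push_le[of "[(a, False)]" "phi \<Sigma> \<kappa> w"] by simp
qed

text \<open>Each letter shifts one exponent sum by one, and cancellation changes none. Hence the
  letter excesses in the counting condition can be read off from the group element.\<close>

lemma exponent_sum_phi:
  assumes "w \<in> lists (\<Sigma> \<union> \<Sigma>')" "b \<in> \<Sigma>"
  shows "exponent_sum b (phi \<Sigma> \<kappa> w) = int (count_list w b) - int (count_list w (\<kappa> b))"
proof -
  have ne: "\<kappa> a \<noteq> c" if "a \<in> \<Sigma>" "c \<in> \<Sigma>" for a c
    using that disj bij by (auto simp: bij_betw_def)
  have inj: "\<kappa> a = \<kappa> c \<longleftrightarrow> a = c" if "a \<in> \<Sigma>" "c \<in> \<Sigma>" for a c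
    using that bij by (auto simp: bij_betw_def inj_on_def)
  show ?thesis
    using assms
  proof (induction w rule: word_induct)
    case Nil
    then show ?case by (simp add: free_group_def exponent_sum_def)
  next
    case (Pos a w)
    then show ?case
      using ne[of b a] by (auto simp: exponent_sum_push) (auto simp: exponent_sum_def)
  next
    case (Neg a w)
    then show ?case
      using ne[of a b] inj[of a b] by (auto simp: exponent_sum_push) (auto simp: exponent_sum_def)
  qed
qed

text \<open>A prefix of \<open>u @ w\<close> either ends inside \<open>u\<close> or extends all of
  \<open>u\<close>; in the second case \<open>u\<close> matters only through its letter excesses,
  hence only through \<open>phi\<close>.\<close>

lemma prefix_dominant_append:
  assumes u: "u \<in> lists (\<Sigma> \<union> \<Sigma>')"
  shows "prefix_dominant \<Sigma> \<kappa> (u @ w) \<longleftrightarrow> prefix_dominant \<Sigma> \<kappa> u \<and>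
    (\<forall>p. prefix p w \<longrightarrow> (\<forall>a\<in>\<Sigma>. int (count_list p (\<kappa> a)) \<le>
       exponent_sum a (phi \<Sigma> \<kappa> u) + int (count_list p a)))"
proof -
  have "int (count_list p (\<kappa> a)) \<le> exponent_sum a (phi \<Sigma> \<kappa> u) + int (count_list p a) \<longleftrightarrow>
      count_list (u @ p) (\<kappa> a) \<le> count_list (u @ p) a" if "a \<in> \<Sigma>" for p a
    using exponent_sum_phi[OF u that] by auto
  then show ?thesis
    unfolding prefix_dominant_def prefix_append by blast
qed

section \<open>Upper bound: residuals are determined by group elements\<close>

lemma dyck_iff:
  "w \<in> dyck \<Sigma> \<Sigma>' \<kappa> \<longleftrightarrow>
    w \<in> lists (\<Sigma> \<union> \<Sigma>') \<and> phi \<Sigma> \<kappa> w = \<one>\<^bsub>free_group \<Sigma>\<^esub> \<and> prefix_dominant \<Sigma> \<kappa> w"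
  by (auto simp: dyck_def prefix_dominant_def)

text \<open>Once \<open>u\<close> is dominant, both conditions on \<open>u @ w\<close> depend on
  \<open>u\<close> only through \<open>phi\<close>. If \<open>w\<close> contains foreign letters,
  both sides are false.\<close>

lemma append_in_dyck_cong:
  assumes "u \<in> lists (\<Sigma> \<union> \<Sigma>')" "v \<in> lists (\<Sigma> \<union> \<Sigma>')"
    and "prefix_dominant \<Sigma> \<kappa> u" "prefix_dominant \<Sigma> \<kappa> v" and "phi \<Sigma> \<kappa> u = phi \<Sigma> \<kappa> v"
  shows "u @ w \<in> dyck \<Sigma> \<Sigma>' \<kappa> \<longleftrightarrow> v @ w \<in> dyck \<Sigma> \<Sigma>' \<kappa>"
proof (cases "w \<in> lists (\<Sigma> \<union> \<Sigma>')")
  case True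
  then show ?thesis
    unfolding dyck_iff prefix_dominant_append[OF assms(1)] prefix_dominant_append[OF assms(2)]
      phi_append[OF assms(1) True] phi_append[OF assms(2) True]
    using assms by simp
qed (auto simp: dyck_iff)

text \<open>The images of \<open>u\<close> and \<open>w\<close> are mutually inverse, and
  \<open>phi\<close> never lengthens a word.\<close>

lemma length_phi_le_completion:
  assumes "u @ w \<in> dyck \<Sigma> \<Sigma>' \<kappa>"
  shows "length (phi \<Sigma> \<kappa> u) \<le> length w"
proof -
  interpret F: group "free_group \<Sigma>" by (rule free_group_is_group)
  have uw: "u \<in> lists (\<Sigma> \<union> \<Sigma>')" "w \<in> lists (\<Sigma> \<union> \<Sigma>')"
    using assms by (auto simp: dyck_iff)
  then have "phi \<Sigma> \<kappa> u \<otimes>\<^bsub>free_group \<Sigma>\<^esub> phi \<Sigma> \<kappa> w = \<one>\<^bsub>free_group \<Sigma>\<^esub>"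
    using assms by (simp add: dyck_iff flip: phi_append)
  \<comment> \<open>The factors are swapped so that the element to be bounded is the right one, as
    in \<open>length_foldr_push_ge\<close>.\<close>
  then have "phi \<Sigma> \<kappa> w \<otimes>\<^bsub>free_group \<Sigma>\<^esub> phi \<Sigma> \<kappa> u = \<one>\<^bsub>free_group \<Sigma>\<^esub>"
    using F.inv_comm phi_closed[OF disj bij uw(1)] phi_closed[OF disj bij uw(2)] by blast
  then have "length (phi \<Sigma> \<kappa> u) \<le> length (phi \<Sigma> \<kappa> w)"
    using length_foldr_push_ge[of "phi \<Sigma> \<kappa> u" "phi \<Sigma> \<kappa> w"] by (simp add: free_group_def)
  then show ?thesis
    using length_phi_le[OF uw(2)] by simp
qed

text \<open>A residual is empty or determined by an element of the ball. The summand 1 counts the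
  empty residual, shared by all words without a completion of length at most
  \<open>n\<close>.\<close>

lemma gamma_dyck_le:
  assumes "finite \<Sigma>"
  shows "gamma (\<Sigma> \<union> \<Sigma>') (dyck \<Sigma> \<Sigma>' \<kappa>) (words_upto (\<Sigma> \<union> \<Sigma>') n) \<le>
    1 + card (\<Union>m\<le>n. reduced_words \<Sigma> m)"
proof -
  let ?\<Delta> = "\<Sigma> \<union> \<Sigma>'" and ?B = "\<Union>m\<le>n. reduced_words \<Sigma> m"
  define f where "f u = {w \<in> words_upto ?\<Delta> n. u @ w \<in> dyck \<Sigma> \<Sigma>' \<kappa>}" for u
  \<comment> \<open>\<open>rep\<close> picks a dominant word over each group element. Where none
    exists its value is arbitrary, which is harmless in an upper bound.\<close>
  define rep where
    "rep g = (SOME u. u \<in> lists ?\<Delta> \<and> prefix_dominant \<Sigma> \<kappa> u \<and> phi \<Sigma> \<kappa> u = g)" for g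
  have "f u \<in> insert {} ((\<lambda>g. f (rep g)) ` ?B)" if u: "u \<in> lists ?\<Delta>" for u
  proof (cases "f u = {}")
    case False
    then obtain w where w: "u @ w \<in> dyck \<Sigma> \<Sigma>' \<kappa>" "length w \<le> n"
      by (auto simp: f_def words_upto_def)
    then have dom: "prefix_dominant \<Sigma> \<kappa> u"
      using prefix_dominant_append[OF u] by (simp add: dyck_iff)
    let ?v = "rep (phi \<Sigma> \<kappa> u)"
    have v: "?v \<in> lists ?\<Delta>" "prefix_dominant \<Sigma> \<kappa> ?v" "phi \<Sigma> \<kappa> ?v = phi \<Sigma> \<kappa> u"
      using someI[of "\<lambda>v. v \<in> lists ?\<Delta> \<and> prefix_dominant \<Sigma> \<kappa> v \<and> phi \<Sigma> \<kappa> v = phi \<Sigma> \<kappa> u" u] u dom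
      unfolding rep_def by blast+
    have "f u = f ?v"
      unfolding f_def using append_in_dyck_cong[OF u v(1) dom v(2)] v(3) by simp
    moreover have "phi \<Sigma> \<kappa> u \<in> ?B"
      using phi_closed[OF disj bij u] length_phi_le_completion[OF w(1)] w(2)
      by (auto simp: reduced_words_def free_group_def)
    ultimately show ?thesis by blast
  qed simp
  moreover have fin: "finite ?B"
    using assms by (simp add: finite_reduced_words)
  ultimately have "card (f ` lists ?\<Delta>) \<le> card (insert {} ((\<lambda>g. f (rep g)) ` ?B))"
    by (intro card_mono) auto
  also have "\<dots> \<le> 1 + card ?B"
    using card_image_le[OF fin, of "\<lambda>g. f (rep g)"] fin by (simp add: card_insert_if)
  finally show ?thesis
    unfolding gamma_eq_card_residuals f_def .
qed

section \<open>Lower bound: positive words and their formal inverses\<close>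

lemma phi_positive: "u \<in> lists \<Sigma> \<Longrightarrow> phi \<Sigma> \<kappa> u = map (\<lambda>a. (a, True)) u"
proof (induction u rule: lists.induct)
  case Nil
  then show ?case by (simp add: free_group_def)
next
  case (Cons a u)
  then show ?case using reduced_positive[of "a # u"] by (cases u) auto
qed

text \<open>The letters cancel from the middle outwards. A prefix has no barred letter until all of
  \<open>u\<close> is read, and afterwards at most as many as \<open>u\<close> provides for.\<close>

lemma positive_completion_in_dyck:
  assumes u: "u \<in> lists \<Sigma>"
  shows "u @ rev (map \<kappa> u) \<in> dyck \<Sigma> \<Sigma>' \<kappa>"
proof -
  have inl: "v \<in> lists (\<Sigma> \<union> \<Sigma>')" "rev (map \<kappa> v) \<in> lists (\<Sigma> \<union> \<Sigma>')" if "v \<in> lists \<Sigma>" for v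
    using that bij by (auto simp: bij_betw_def)
  have "phi \<Sigma> \<kappa> (u @ rev (map \<kappa> u)) = \<one>\<^bsub>free_group \<Sigma>\<^esub>"
    using u
  \<comment> \<open>Appending \<open>a\<close> to \<open>u\<close> inserts the cancelling pair
    \<open>a\<close>, \<open>\<kappa> a\<close> in the middle, hence induction from the right
    end.\<close>
  proof (induction u rule: rev_induct)
    case (snoc a u)
    then have a: "a \<in> \<Sigma>" and u: "u \<in> lists \<Sigma>" by auto
    let ?w = "rev (map \<kappa> u)"
    have red: "reduced (phi \<Sigma> \<kappa> ?w)"
      using phi_closed[OF disj bij inl(2)[OF u]] by (simp add: free_group_def)
    have "a # \<kappa> a # ?w \<in> lists (\<Sigma> \<union> \<Sigma>')"
      using inl(2)[OF u] a bij by (auto simp: bij_betw_def)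
    then have "phi \<Sigma> \<kappa> (u @ a # \<kappa> a # ?w) =
        phi \<Sigma> \<kappa> u \<otimes>\<^bsub>free_group \<Sigma>\<^esub> phi \<Sigma> \<kappa> (a # \<kappa> a # ?w)"
      by (rule phi_append[OF inl(1)[OF u]])
    also have "phi \<Sigma> \<kappa> (a # \<kappa> a # ?w) = phi \<Sigma> \<kappa> ?w"
      using a push_inv[OF red, of "(a, True)"] by (simp add: inv_letter_def)
    also have "phi \<Sigma> \<kappa> u \<otimes>\<^bsub>free_group \<Sigma>\<^esub> phi \<Sigma> \<kappa> ?w = \<one>\<^bsub>free_group \<Sigma>\<^esub>"
      using snoc.IH[OF u] phi_append[OF inl[OF u]] by simp
    finally show ?case by simp
  qed simp
  moreover have "prefix_dominant \<Sigma> \<kappa> (u @ rev (map \<kappa> u))"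
  proof -
    have pos: "count_list p (\<kappa> a) = 0" if "prefix p u" "a \<in> \<Sigma>" for p a
    proof -
      have "\<kappa> a \<notin> set p"
        using that u disj bij set_mono_prefix[OF that(1)] by (auto simp: bij_betw_def)
      then show ?thesis by simp
    qed
    have cnt: "count_list (rev (map \<kappa> u)) (\<kappa> a) = count_list u a" if "a \<in> \<Sigma>" for a
    proof -
      have inj: "inj_on \<kappa> (insert a (set u))"
        by (rule inj_on_subset[OF bij_betw_imp_inj_on[OF bij]]) (use u that in auto)
      have "count_list (map \<kappa> u) (\<kappa> a) = count_list u a"
      proof (cases "a \<in> set u")
        case True
        then show ?thesis using inj by (simp add: count_list_inj_map)
      next
        case False
        then have "\<kappa> a \<notin> set (map \<kappa> u)" using inj by auto
        with False show ?thesis by (metis count_notin)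
      qed
      then show ?thesis by simp
    qed
    have neg: "count_list p (\<kappa> a) \<le> count_list u a"
      if p: "prefix p (rev (map \<kappa> u))" and a: "a \<in> \<Sigma>" for p a
    proof -
      obtain q where "rev (map \<kappa> u) = p @ q" using p by (rule prefixE)
      then have "count_list p (\<kappa> a) \<le> count_list (rev (map \<kappa> u)) (\<kappa> a)"
        by (simp only: count_list_append le_add1)
      then show ?thesis by (simp only: cnt[OF a])
    qed
    show ?thesis
      unfolding prefix_dominant_def
    proof (intro allI impI ballI)
      fix p a assume p: "prefix p (u @ rev (map \<kappa> u))" and a: "a \<in> \<Sigma>"
      consider "prefix p u" | q where "p = u @ q" "prefix q (rev (map \<kappa> u))"
        using p by (auto simp: prefix_append)
      then show "count_list p (\<kappa> a) \<le> count_list p a"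
      proof cases
        case 1
        then show ?thesis using pos a by simp
      next
        case (2 q)
        then show ?thesis using pos[of u a] neg[of q a] a by simp
      qed
    qed
  qed
  ultimately show ?thesis
    using inl[OF u] by (simp add: dyck_iff)
qed

text \<open>Right cancellation gives equal images, and \<open>phi\<close> is injective on positive
  words because these are already reduced.\<close>

lemma positive_completion_unique:
  assumes u: "u \<in> lists \<Sigma>" and v: "v \<in> lists \<Sigma>"
    and "u @ w \<in> dyck \<Sigma> \<Sigma>' \<kappa>" "v @ w \<in> dyck \<Sigma> \<Sigma>' \<kappa>"
  shows "u = v"
proof -
  interpret F: group "free_group \<Sigma>" by (rule free_group_is_group)
  have inl: "u \<in> lists (\<Sigma> \<union> \<Sigma>')" "v \<in> lists (\<Sigma> \<union> \<Sigma>')" "w \<in> lists (\<Sigma> \<union> \<Sigma>')"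
    using assms by (auto simp: dyck_iff)
  have "phi \<Sigma> \<kappa> u \<otimes>\<^bsub>free_group \<Sigma>\<^esub> phi \<Sigma> \<kappa> w = phi \<Sigma> \<kappa> v \<otimes>\<^bsub>free_group \<Sigma>\<^esub> phi \<Sigma> \<kappa> w"
    using assms inl by (simp add: dyck_iff flip: phi_append)
  then have "phi \<Sigma> \<kappa> u = phi \<Sigma> \<kappa> v"
    using inl by (simp add: phi_closed[OF disj bij] F.right_cancel del: in_lists_conv_set)
  then show ?thesis
    by (simp add: phi_positive u v inj_map_eq_map inj_on_def del: in_lists_conv_set)
qed

text \<open>The completion of a positive word has the same length, so tests of length at most
  \<open>n\<close> separate all positive words of length \<open>n\<close>.\<close>

lemma gamma_dyck_ge:
  assumes "finite \<Sigma>"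
  shows "card \<Sigma> ^ n \<le> gamma (\<Sigma> \<union> \<Sigma>') (dyck \<Sigma> \<Sigma>' \<kappa>) (words_upto (\<Sigma> \<union> \<Sigma>') n)"
proof -
  let ?U = "{u. set u \<subseteq> \<Sigma> \<and> length u = n}"
  have "finite \<Sigma>'"
    using assms bij bij_betw_finite by blast
  then have "finite (words_upto (\<Sigma> \<union> \<Sigma>') n)"
    using assms by (simp add: finite_words_upto)
  moreover have "?U \<subseteq> lists (\<Sigma> \<union> \<Sigma>')" by auto
  moreover have "\<exists>w\<in>words_upto (\<Sigma> \<union> \<Sigma>') n. u @ w \<in> dyck \<Sigma> \<Sigma>' \<kappa> \<and> v @ w \<notin> dyck \<Sigma> \<Sigma>' \<kappa>"
    if "u \<in> ?U" "v \<in> ?U" "u \<noteq> v" for u v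
  proof (intro bexI conjI)
    have uv: "u \<in> lists \<Sigma>" "v \<in> lists \<Sigma>" using that by auto
    \<comment> \<open>Solving this goal instantiates the witness by the formal inverse of
      \<open>u\<close>.\<close>
    show dyck: "u @ rev (map \<kappa> u) \<in> dyck \<Sigma> \<Sigma>' \<kappa>"
      by (rule positive_completion_in_dyck) (rule uv)
    then show "v @ rev (map \<kappa> u) \<notin> dyck \<Sigma> \<Sigma>' \<kappa>"
      using positive_completion_unique[OF uv] that(3) by blast
    show "rev (map \<kappa> u) \<in> words_upto (\<Sigma> \<union> \<Sigma>') n"
      using dyck that(1) by (auto simp: dyck_iff words_upto_def)
  qed
  ultimately have "card ?U \<le> gamma (\<Sigma> \<union> \<Sigma>') (dyck \<Sigma> \<Sigma>' \<kappa>) (words_upto (\<Sigma> \<union> \<Sigma>') n)"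
    by (rule card_le_gamma)
  then show ?thesis
    using card_lists_length_eq[OF assms] by simp
qed

end

section \<open>From growth bounds to entropy bounds\<close>

lemma MN_entropy_ge:
  assumes b: "b > 0" and le: "\<And>n. b ^ n \<le> real (gamma \<Delta> L (words_upto \<Delta> n))"
  shows "ereal (log 2 b) \<le> MN_entropy \<Delta> L"
  unfolding MN_entropy_def
proof (rule le_Limsup)
  show "\<forall>\<^sub>F n in sequentially.
      ereal (log 2 b) \<le> ereal (1 / real n * log 2 (real (gamma \<Delta> L (words_upto \<Delta> n))))"
    \<comment> \<open>The term at 0 is 0 by division by zero and may lie below
      \<open>log 2 b\<close>, so only positive \<open>n\<close> are compared.\<close>
    using eventually_gt_at_top[of 0]
  proof eventually_elim
    case (elim n)
    have "0 < b ^ n" using b by simp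
    then have "log 2 (b ^ n) \<le> log 2 (real (gamma \<Delta> L (words_upto \<Delta> n)))"
      using le[of n] by (subst log_le_cancel_iff) auto
    then show ?case
      using elim b by (simp add: log_nat_power field_simps)
  qed
qed simp

text \<open>The factor \<open>C * real n\<close> is subexponential: its logarithm divided by
  \<open>n\<close> tends to 0. The bound is assumed for positive \<open>n\<close> because at 0 its
  right side vanishes while \<open>gamma\<close> is positive.\<close>

lemma MN_entropy_le:
  assumes fin: "finite \<Delta>" and b: "b > 0" and C: "C > 0"
    and gamma: "\<And>n. n > 0 \<Longrightarrow> real (gamma \<Delta> L (words_upto \<Delta> n)) \<le> C * real n * b ^ n"
  shows "MN_entropy \<Delta> L \<le> ereal (log 2 b)"
proof -
  have "(\<lambda>n. log 2 (C * real n) / real n + log 2 b) \<longlonglongrightarrow> log 2 b"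
    using C unfolding log_def by real_asymp
  then have lim: "limsup (\<lambda>n. ereal (log 2 (C * real n) / real n + log 2 b)) = ereal (log 2 b)"
    by (intro lim_imp_Limsup) auto
  have "\<forall>\<^sub>F n in sequentially. ereal (1 / real n * log 2 (real (gamma \<Delta> L (words_upto \<Delta> n)))) \<le>
      ereal (log 2 (C * real n) / real n + log 2 b)"
    using eventually_gt_at_top[of 0]
  proof eventually_elim
    case (elim n)
    let ?x = "real (gamma \<Delta> L (words_upto \<Delta> n))"
    have pos: "0 < C * real n * b ^ n" using b C elim by simp
    have "0 < ?x" using gamma_pos[OF fin] by simp
    then have "log 2 ?x \<le> log 2 (C * real n * b ^ n)"
      using gamma[OF elim] pos by (subst log_le_cancel_iff) auto
    also have "\<dots> = log 2 (C * real n) + real n * log 2 b"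
      using b C elim by (simp add: log_mult_pos log_nat_power)
    finally show ?case
      using elim by (simp add: field_simps)
  qed
  then show ?thesis
    unfolding MN_entropy_def lim[symmetric] by (rule Limsup_mono)
qed

theorem theorem4p8:
  fixes \<Sigma> \<Sigma>' :: "'a set" and \<kappa> :: "'a \<Rightarrow> 'a"
  assumes "finite \<Sigma>" and "\<Sigma> \<noteq> {}" and "finite \<Sigma>'" and "\<Sigma>' \<noteq> {}"
    and "\<Sigma> \<inter> \<Sigma>' = {}"
    and "bij_betw \<kappa> \<Sigma> \<Sigma>'"
  shows "ereal (log 2 (real (card \<Sigma>))) \<le> MN_entropy (\<Sigma> \<union> \<Sigma>') (dyck \<Sigma> \<Sigma>' \<kappa>) \<and>
         MN_entropy (\<Sigma> \<union> \<Sigma>') (dyck \<Sigma> \<Sigma>' \<kappa>) \<le> ereal (log 2 (2 * real (card \<Sigma>) - 1))"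
proof -
  let ?g = "\<lambda>n. gamma (\<Sigma> \<union> \<Sigma>') (dyck \<Sigma> \<Sigma>' \<kappa>) (words_upto (\<Sigma> \<union> \<Sigma>') n)"
  let ?k = "card \<Sigma>" and ?b = "2 * card \<Sigma> - 1"
  have k: "?k \<ge> 1"
    using assms by (simp add: Suc_leI card_gt_0_iff)
  have "real ?k ^ n \<le> real (?g n)" for n
    using gamma_dyck_ge[OF assms(5,6,1), of n] unfolding of_nat_power[symmetric] of_nat_le_iff .
  then have lower: "ereal (log 2 (real ?k)) \<le> MN_entropy (\<Sigma> \<union> \<Sigma>') (dyck \<Sigma> \<Sigma>' \<kappa>)"
    using k by (intro MN_entropy_ge) auto
  \<comment> \<open>The summand 2 collects the empty residual and the empty reduced word; it is
    absorbed into the product since \<open>n\<close> and \<open>?b\<close> are at least 1.\<close>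
  have "?g n \<le> (2 * ?k + 2) * n * ?b ^ n" if "n > 0" for n
  proof -
    have "?g n \<le> 2 + 2 * ?k * n * ?b ^ n"
      using gamma_dyck_le[OF assms(5,6,1), of n] card_ball_le[OF assms(1,2), of n] by simp
    also have "\<dots> \<le> 2 * (n * ?b ^ n) + 2 * ?k * n * ?b ^ n"
      using that k by (simp add: Suc_leI)
    finally show ?thesis by (simp add: algebra_simps)
  qed
  then have "real (?g n) \<le> real (2 * ?k + 2) * real n * real ?b ^ n" if "n > 0" for n
    using that unfolding of_nat_mult[symmetric] of_nat_power[symmetric] of_nat_le_iff by blast
  then have "MN_entropy (\<Sigma> \<union> \<Sigma>') (dyck \<Sigma> \<Sigma>' \<kappa>) \<le> ereal (log 2 (real ?b))"
    using k assms by (intro MN_entropy_le[where C = "real (2 * ?k + 2)"]) auto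
  \<comment> \<open>The subtraction in \<open>?b\<close> is not truncated because \<open>?k\<close>
    is at least 1.\<close>
  moreover have "real ?b = 2 * real ?k - 1"
    using k by (simp add: of_nat_diff)
  ultimately show ?thesis
    using lower by simp
qed

end
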